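(* Let $s(n,k)$ be the number of little Schröder paths of length $2n$ with exactly $k$ hills. Then $s(1,0)=0$, $s(1,1)=1$, and for every integer $n\ge 2$, $$s(n,0)=\sum_{j=1}^{n-1}2\cdot 3^{j-1}\,s(n-1,j),$$ and for every integer $k$ with $1\le k\le n$, $$s(n,k)=s(n-1,k-1)+\sum_{j=k+1}^{n-1}2\cdot 3^{j-k-1}\,s(n-1,j)$$ (empty sums are $0$).
   Context: A Schröder path of length $2n$ is a lattice path from $(0,0)$ to $(2n,0)$ consisting of up steps $U:(x,y)\to(x+1,y+1)$, down steps $D:(x,y)\to(x+1,y-1)$ and horizontal steps $H:(x,y)\to(x+2,y)$, that never goes below the $x$-axis. The height of a step is the $y$-coordinate of its ending point. A little Schröder path is a Schröder path with no horizontal step at height $0$. The empty path is the only (little) Schröder path of length $0$. A peak is an up step immediately followed by a down step, $(x,y)\to(x+1,y+1)\to(x+2,y)$; its height is $y+1$. A hill is a peak at height $1$. For $0\le k\le n$, $s(n,k)$ denotes the number of little Schröder paths of length $2n$ with exactly $k$ hills; $s(0,0)=1$. *)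

theory Defs
  imports Main "HOL-Library.Product_Plus"
begin

datatype step = U | D | H

fun step_vec :: "step \<Rightarrow> int \<times> int" where
  "step_vec U = (1, 1)"
| "step_vec D = (1, -1)"
| "step_vec H = (2, 0)"

text \<open>A lattice path starting at the origin is represented by its list of steps.\<close>

definition end_point :: "step list \<Rightarrow> int \<times> int" where
  "end_point p = sum_list (map step_vec p)"

definition schroeder_path :: "nat \<Rightarrow> step list \<Rightarrow> bool" where
  "schroeder_path n p \<longleftrightarrow>
     end_point p = (2 * int n, 0) \<and> (\<forall>i\<le>length p. 0 \<le> snd (end_point (take i p)))"

text \<open>Steps are numbered from 0. The height of a step is the ordinate of its ending point, that
  is, of the point reached after the first \<open>Suc i\<close> steps.\<close>

definition step_height :: "step list \<Rightarrow> nat \<Rightarrow> int" where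
  "step_height p i = snd (end_point (take (Suc i) p))"

definition little_schroeder_path :: "nat \<Rightarrow> step list \<Rightarrow> bool" where
  "little_schroeder_path n p \<longleftrightarrow>
     schroeder_path n p \<and> \<not> (\<exists>i<length p. p ! i = H \<and> step_height p i = 0)"

definition peak_at :: "step list \<Rightarrow> nat \<Rightarrow> bool" where
  "peak_at p i \<longleftrightarrow> Suc i < length p \<and> p ! i = U \<and> p ! Suc i = D"

text \<open>The height of a peak is the height of its up step.\<close>

definition hills :: "step list \<Rightarrow> nat set" where
  "hills p = {i. peak_at p i \<and> step_height p i = 1}"

definition s :: "nat \<Rightarrow> nat \<Rightarrow> nat" where
  "s n k = card {p. little_schroeder_path n p \<and> card (hills p) = k}"

text \<open>Both cardinalities above are of finite sets.\<close>

lemma finite_hills: "finite (hills p)"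
  by (rule finite_subset[of _ "{..<length p}"]) (auto simp: hills_def peak_at_def)

lemma length_le_end_point: "int (length p) \<le> fst (end_point p)"
proof (induction p)
  case (Cons a p)
  then show ?case by (cases a) (auto simp: end_point_def)
qed (simp add: end_point_def)

lemma finite_little_schroeder_paths: "finite {p. little_schroeder_path n p}"
proof (rule finite_subset)
  have "length p \<le> 2 * n" if "little_schroeder_path n p" for p
    using that length_le_end_point[of p]
    by (simp add: little_schroeder_path_def schroeder_path_def)
  moreover have "set p \<subseteq> {U, D, H}" for p
    using step.exhaust by blast
  ultimately show "{p. little_schroeder_path n p}
      \<subseteq> {p. set p \<subseteq> {U, D, H} \<and> length p \<le> 2 * n}"
    by blast
  show "finite {p. set p \<subseteq> {U, D, H} \<and> length p \<le> 2 * n}"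
    by (rule finite_lists_length_le) simp
qed

end

theory Submission
  imports Defs "HOL-Computational_Algebra.Formal_Power_Series"
begin

text \<open>
  Schroeder paths are parsed into trees by their first return to the axis. Counting trees,
  let \<open>P\<close> be the generating function of the nonempty Schroeder paths and \<open>A k\<close> that of the little
  Schroeder paths with \<open>k\<close> hills, both by half length. Then \<open>P = X (1 + P) (2 + P)\<close>,
  \<open>A 0 = 1 + X P A 0\<close> and \<open>A k = F (X F)\<^sup>k\<close> with \<open>F = A 0\<close>. Eliminating \<open>P\<close> yields
  \<open>F - 1 = 2 y\<^sup>2 + 3 y (F - 1)\<close> for \<open>y = X F\<close>. Multiplied by \<open>y\<^sup>k\<close> this
  says that \<open>R k = (F - 1) y\<^sup>k\<close>, which is \<open>A k - X A (k - 1)\<close> for \<open>k \<ge> 1\<close>, satisfies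
  \<open>R k = 2 X A (k + 1) + 3 R (k + 1)\<close>; iterating gives the theorem.
\<close>

section \<open>Trees\<close>

datatype tree = Leaf | Flat tree | Arch tree tree

fun word :: "tree \<Rightarrow> step list" where
  "word Leaf = []"
| "word (Flat t) = H # word t"
| "word (Arch t u) = U # word t @ D # word u"

fun semilength :: "tree \<Rightarrow> nat" where
  "semilength Leaf = 0"
| "semilength (Flat t) = Suc (semilength t)"
| "semilength (Arch t u) = Suc (semilength t + semilength u)"

text \<open>Only the chain of right subtrees lies on the axis. The content of an arch is raised by
  1, so it is unrestricted here; \<open>hill_count\<close> only asks whether it is empty.\<close>

fun little :: "tree \<Rightarrow> bool" where
  "little Leaf = True"
| "little (Flat t) = False"
| "little (Arch t u) = little u"

fun hill_count :: "tree \<Rightarrow> nat" where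
  "hill_count Leaf = 0"
| "hill_count (Flat t) = hill_count t"
| "hill_count (Arch t u) = (if t = Leaf then 1 else 0) + hill_count u"

text \<open>A path descending from height \<open>h\<close> to the axis is cut by its \<open>h\<close> first-passage down steps
  into \<open>h + 1\<close> Schroeder paths; \<open>parse\<close> returns their list.\<close>

fun parse :: "step list \<Rightarrow> tree list" where
  "parse [] = [Leaf]"
| "parse (D # p) = Leaf # parse p"
| "parse (H # p) = (case parse p of t # ts \<Rightarrow> Flat t # ts | [] \<Rightarrow> [])"
| "parse (U # p) = (case parse p of t # u # ts \<Rightarrow> Arch t u # ts | _ \<Rightarrow> [])"

fun forest_word :: "tree list \<Rightarrow> step list" where
  "forest_word [] = []"
| "forest_word [t] = word t"
| "forest_word (t # u # ts) = word t @ D # forest_word (u # ts)"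

text \<open>The suffix \<open>q\<close> is general so that the induction can pass through the
  content of an arch; \<open>q = []\<close> recovers \<open>t\<close> from
  \<open>word t\<close>.\<close>

lemma parse_word_append: "parse q = Leaf # ts \<Longrightarrow> parse (word t @ q) = t # ts"
  by (induction t arbitrary: q ts) auto

lemma inj_word: "inj word"
proof (rule injI)
  fix t u assume "word t = word u"
  then show "t = u"
    using parse_word_append[of "[]" "[]" t] parse_word_append[of "[]" "[]" u] by simp
qed

section \<open>Paths started at an arbitrary height\<close>

lemma end_point_simps [simp]:
  "end_point [] = 0"
  "end_point (a # p) = step_vec a + end_point p"
  "end_point (p @ q) = end_point p + end_point q"
  by (simp_all add: end_point_def)

text \<open>The starting height is a parameter so that these notions recurse on the first step,
  which shifts \<open>h\<close> by its rise.\<close>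

definition descends :: "int \<Rightarrow> step list \<Rightarrow> bool" where
  "descends h p \<longleftrightarrow>
     h + snd (end_point p) = 0 \<and> (\<forall>i\<le>length p. 0 \<le> h + snd (end_point (take i p)))"

definition no_flat_from :: "int \<Rightarrow> step list \<Rightarrow> bool" where
  "no_flat_from h p \<longleftrightarrow> \<not> (\<exists>i<length p. p ! i = H \<and> h + step_height p i = 0)"

definition hills_from :: "int \<Rightarrow> step list \<Rightarrow> nat set" where
  "hills_from h p = {i. peak_at p i \<and> h + step_height p i = 1}"

lemma all_le_Suc: "(\<forall>i\<le>Suc n. P i) \<longleftrightarrow> P 0 \<and> (\<forall>i\<le>n. P (Suc i))"
  by (metis Suc_le_mono le0 not0_implies_Suc)

lemma descends_Nil [simp]: "descends h [] \<longleftrightarrow> h = 0"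
  by (auto simp: descends_def)

lemma descends_Cons [simp]:
  "descends h (a # p) \<longleftrightarrow> 0 \<le> h \<and> descends (h + snd (step_vec a)) p"
  by (auto simp: descends_def all_le_Suc add.assoc)

lemma descends_nonneg: "descends h p \<Longrightarrow> 0 \<le> h"
  by (cases p) auto

lemma schroeder_path_iff:
  "schroeder_path n p \<longleftrightarrow> fst (end_point p) = 2 * int n \<and> descends 0 p"
  by (auto simp: schroeder_path_def descends_def prod_eq_iff)

lemma step_height_Cons [simp]:
  "step_height (a # p) 0 = snd (step_vec a)"
  "step_height (a # p) (Suc i) = snd (step_vec a) + step_height p i"
  by (simp_all add: step_height_def)

lemma no_flat_from_Nil [simp]: "no_flat_from h []"
  by (simp add: no_flat_from_def)

lemma no_flat_from_Cons [simp]: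
  "no_flat_from h (a # p) \<longleftrightarrow> (a = H \<longrightarrow> h \<noteq> 0) \<and> no_flat_from (h + snd (step_vec a)) p"
  by (auto simp: no_flat_from_def Ex_less_Suc2 add.assoc)

lemma hills_from_Nil [simp]: "hills_from h [] = {}"
  by (simp add: hills_from_def peak_at_def)

lemma finite_hills_from: "finite (hills_from h p)"
  by (rule finite_subset[of _ "{..<length p}"]) (auto simp: hills_from_def peak_at_def)

lemma peak_at_Cons:
  "peak_at (a # p) 0 \<longleftrightarrow> a = U \<and> p \<noteq> [] \<and> hd p = D"
  "peak_at (a # p) (Suc i) \<longleftrightarrow> peak_at p i"
  by (cases p; auto simp: peak_at_def)+

lemma card_hills_from_Cons [simp]:
  "card (hills_from h (a # p)) =
     (if a = U \<and> h = 0 \<and> p \<noteq> [] \<and> hd p = D then 1 else 0)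
       + card (hills_from (h + snd (step_vec a)) p)"
proof -
  let ?c = "a = U \<and> h = 0 \<and> p \<noteq> [] \<and> hd p = D"
  have "i \<in> hills_from h (a # p) \<longleftrightarrow>
      i \<in> (if ?c then {0} else {}) \<union> Suc ` hills_from (h + snd (step_vec a)) p" for i
    by (cases i) (auto simp: hills_from_def peak_at_Cons add.assoc)
  then have "hills_from h (a # p) =
      (if ?c then {0} else {}) \<union> Suc ` hills_from (h + snd (step_vec a)) p"
    by blast
  then show ?thesis
    by (auto simp: card_insert_if finite_hills_from card_image)
qed

section \<open>Little Schroeder paths as trees\<close>

lemma descends_word_append: "descends h q \<Longrightarrow> descends h (word t @ q)"
proof (induction t arbitrary: h q)
  case (Arch t u)
  then show ?case
    using descends_nonneg[OF Arch.prems] by (auto intro!: Arch.IH)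
qed (auto dest: descends_nonneg)

lemma fst_end_point_word: "fst (end_point (word t)) = 2 * int (semilength t)"
  by (induction t) auto

text \<open>The word of a tree started at height \<open>h\<close> never goes below \<open>h\<close>,
  so none of its steps ends on the axis; likewise all its peaks are higher than 1.\<close>

lemma no_flat_from_word_append:
  "0 < h \<Longrightarrow> no_flat_from h (word t @ q) \<longleftrightarrow> no_flat_from h q"
  by (induction t arbitrary: h q) auto

lemma no_flat_from_word: "no_flat_from 0 (word t) \<longleftrightarrow> little t"
  by (induction t) (auto simp: no_flat_from_word_append)

lemma hills_from_word_append:
  "0 < h \<Longrightarrow> card (hills_from h (word t @ q)) = card (hills_from h q)"
  by (induction t arbitrary: h q) auto

text \<open>A nonempty word starts with \<open>U\<close> or \<open>H\<close>, so the up step of an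
  arch begins a peak only if the content is empty.\<close>

lemma hd_word_append: "hd (word t @ D # q) = D \<longleftrightarrow> t = Leaf"
  by (cases t) auto

lemma hills_from_word: "card (hills_from 0 (word t)) = hill_count t"
  by (induction t) (auto simp: hills_from_word_append hd_word_append)

text \<open>Counting the trees rules out the default \<open>[]\<close> in \<open>parse\<close>: the
  rest after \<open>U\<close> descends from \<open>h + 1\<close>, hence yields at least two
  trees.\<close>

lemma forest_word_parse:
  "descends h p \<Longrightarrow> int (length (parse p)) = h + 1 \<and> forest_word (parse p) = p"
proof (induction p arbitrary: h)
  case (Cons a p)
  then have h: "0 \<le> h"
    and IH: "int (length (parse p)) = h + snd (step_vec a) + 1" "forest_word (parse p) = p"
    by auto
  show ?case
  proof (cases a)
    case U
    then obtain t u ts where "parse p = t # u # ts"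
      using h IH(1) by (cases "parse p" rule: forest_word.cases) auto
    with U IH h show ?thesis by (cases ts) auto
  next
    case D
    moreover have "0 \<le> h + snd (step_vec a)"
      using Cons.prems descends_nonneg by auto
    ultimately obtain t ts where "parse p = t # ts"
      using IH(1) by (cases "parse p") auto
    with D IH show ?thesis by auto
  next
    case H
    then obtain t ts where "parse p = t # ts"
      using h IH(1) by (cases "parse p") auto
    with H IH show ?thesis by (cases ts) auto
  qed
qed simp

lemma descends_0_iff: "descends 0 p \<longleftrightarrow> p \<in> range word"
proof
  assume *: "descends 0 p"
  then obtain t where "parse p = [t]"
    using forest_word_parse[OF *] by (cases "parse p" rule: forest_word.cases) auto
  then show "p \<in> range word"
    using forest_word_parse[OF *] by auto
next
  assume "p \<in> range word"
  then show "descends 0 p"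
    using descends_word_append[of 0 "[]"] by auto
qed

definition trees :: "nat \<Rightarrow> tree set" where
  "trees n = {t. semilength t = n}"

definition little_trees :: "nat \<Rightarrow> nat \<Rightarrow> tree set" where
  "little_trees n k = {t. semilength t = n \<and> little t \<and> hill_count t = k}"

lemma s_eq_card_trees: "s n k = card (little_trees n k)"
proof -
  have "little_schroeder_path n p \<and> card (hills p) = k \<longleftrightarrow> p \<in> word ` little_trees n k" for p
  proof -
    have "little_schroeder_path n p \<longleftrightarrow>
        fst (end_point p) = 2 * int n \<and> p \<in> range word \<and> no_flat_from 0 p"
      by (auto simp: little_schroeder_path_def schroeder_path_iff descends_0_iff no_flat_from_def)
    moreover have "hills p = hills_from 0 p"
      by (simp add: hills_def hills_from_def)
    ultimately show ?thesis
      by (auto simp: little_trees_def fst_end_point_word no_flat_from_word hills_from_word)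
  qed
  then have "{p. little_schroeder_path n p \<and> card (hills p) = k} = word ` little_trees n k"
    by blast
  then show ?thesis
    using card_image[OF inj_on_subset[OF inj_word]] by (simp add: s_def)
qed

section \<open>Counting trees\<close>

lemma semilength_eq_0_iff [simp]: "semilength t = 0 \<longleftrightarrow> t = Leaf"
  by (cases t) auto

lemma trees_0: "trees 0 = {Leaf}"
  by (auto simp: trees_def)

lemma trees_Suc:
  "trees (Suc n) = Flat ` trees n \<union> (\<Union>m\<le>n. case_prod Arch ` (trees m \<times> trees (n - m)))"
proof -
  have "t \<in> trees (Suc n) \<longleftrightarrow>
      t \<in> Flat ` trees n \<union> (\<Union>m\<le>n. case_prod Arch ` (trees m \<times> trees (n - m)))" for t
    by (cases t) (auto simp: trees_def image_iff)
  then show ?thesis by blast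
qed

lemma finite_trees: "finite (trees n)"
proof (induction n rule: less_induct)
  case (less n)
  then show ?case by (cases n) (auto simp: trees_0 trees_Suc)
qed

lemma finite_little_trees: "finite (little_trees n k)"
  by (rule finite_subset[OF _ finite_trees[of n]]) (auto simp: little_trees_def trees_def)

lemma inj_Arch: "inj_on (case_prod Arch) A"
  by (auto intro: inj_onI)

text \<open>The semilength of the left subtree determines \<open>m\<close>, so the union is
  disjoint.\<close>

lemma card_UN_Arch:
  assumes "\<And>m. m \<in> M \<Longrightarrow> B m \<subseteq> trees m" "\<And>m. finite (C m)" "finite M"
  shows "card (\<Union>m\<in>M. case_prod Arch ` (B m \<times> C m)) = (\<Sum>m\<in>M. card (B m) * card (C m))"
proof -
  have "finite (B m)" if "m \<in> M" for m
    using that assms finite_trees finite_subset by blast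
  then have "card (\<Union>m\<in>M. case_prod Arch ` (B m \<times> C m))
      = (\<Sum>m\<in>M. card (case_prod Arch ` (B m \<times> C m)))"
    using assms by (intro card_UN_disjoint) (auto simp: trees_def, blast)
  then show ?thesis
    by (simp add: card_image[OF inj_Arch] card_cartesian_product)
qed

lemma card_trees_Suc:
  "card (trees (Suc n)) = card (trees n) + (\<Sum>m\<le>n. card (trees m) * card (trees (n - m)))"
proof -
  have "card (trees (Suc n)) = card (Flat ` trees n)
      + card (\<Union>m\<le>n. case_prod Arch ` (trees m \<times> trees (n - m)))"
    unfolding trees_Suc by (intro card_Un_disjoint) (auto simp: finite_trees)
  then show ?thesis
    by (simp add: card_UN_Arch finite_trees card_image inj_on_def)
qed

lemma s_0: "s 0 k = (if k = 0 then 1 else 0)"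
proof -
  have "little_trees 0 k = (if k = 0 then {Leaf} else {})"
    by (auto simp: little_trees_def)
  then show ?thesis by (simp add: s_eq_card_trees)
qed

text \<open>The arch with empty content is split off since it alone adds a hill; hence
  \<open>m\<close> starts at 1.\<close>

lemma little_trees_Suc:
  "little_trees (Suc n) k =
     (if k = 0 then {} else Arch Leaf ` little_trees n (k - 1))
       \<union> (\<Union>m\<in>{1..n}. case_prod Arch ` (trees m \<times> little_trees (n - m) k))"
proof -
  have "t \<in> little_trees (Suc n) k \<longleftrightarrow>
      t \<in> (if k = 0 then {} else Arch Leaf ` little_trees n (k - 1))
       \<union> (\<Union>m\<in>{1..n}. case_prod Arch ` (trees m \<times> little_trees (n - m) k))" for t
    by (cases t) (auto simp: trees_def little_trees_def image_iff Suc_le_eq neq0_conv[symmetric]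
        simp del: neq0_conv)
  then show ?thesis by blast
qed

lemma s_Suc:
  "s (Suc n) k = (if k = 0 then 0 else s n (k - 1)) + (\<Sum>m=1..n. card (trees m) * s (n - m) k)"
proof -
  have "card (little_trees (Suc n) k)
      = card (if k = 0 then {} else Arch Leaf ` little_trees n (k - 1))
        + card (\<Union>m\<in>{1..n}. case_prod Arch ` (trees m \<times> little_trees (n - m) k))"
    unfolding little_trees_Suc
    by (intro card_Un_disjoint) (auto simp: finite_trees finite_little_trees, simp add: trees_def)
  then show ?thesis
    by (simp add: s_eq_card_trees card_UN_Arch finite_little_trees card_image inj_on_def)
qed

section \<open>Generating functions\<close>

unbundle fps_syntax

definition P :: "int fps" where
  "P = Abs_fps (\<lambda>n. if n = 0 then 0 else int (card (trees n)))"

definition A :: "nat \<Rightarrow> int fps" where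
  "A k = Abs_fps (\<lambda>n. int (s n k))"

lemma one_plus_P_nth: "(1 + P) $ n = int (card (trees n))"
  by (simp add: P_def trees_0)

lemma P_eq: "P = fps_X * (1 + P) * (2 + P)"
proof -
  \<comment> \<open>A Schroeder path is empty, starts with \<open>H\<close>, or starts with an
    arch.\<close>
  have "1 + P = 1 + fps_X * ((1 + P) + (1 + P) * (1 + P))"
  proof (rule fps_ext)
    fix n
    show "(1 + P) $ n = (1 + fps_X * ((1 + P) + (1 + P) * (1 + P))) $ n"
    proof (cases n)
      case 0
      then show ?thesis by (simp add: P_def)
    next
      case (Suc m)
      have "(1 + fps_X * ((1 + P) + (1 + P) * (1 + P))) $ n
          = (1 + P) $ m + ((1 + P) * (1 + P)) $ m"
        by (simp only: Suc fps_add_nth fps_X_mult_nth fps_one_nth) simp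
      also have "\<dots> = int (card (trees n))"
        by (simp only: fps_mult_nth one_plus_P_nth Suc card_trees_Suc) (simp add: atLeast0AtMost)
      finally show ?thesis by (simp only: one_plus_P_nth)
    qed
  qed
  then show ?thesis by (simp add: algebra_simps)
qed

lemma P_mult_A_nth: "(P * A k) $ n = (\<Sum>m=1..n. int (card (trees m)) * int (s (n - m) k))"
  by (simp add: fps_mult_nth P_def A_def sum.atLeast_Suc_atMost)

lemma A_0: "A 0 = 1 + fps_X * P * A 0"
proof (rule fps_ext)
  fix n show "A 0 $ n = (1 + fps_X * P * A 0) $ n"
    unfolding mult.assoc
    by (cases n) (simp_all add: P_mult_A_nth, simp_all add: A_def s_0 s_Suc)
qed

text \<open>The first arch is a hill, leaving \<open>k\<close> hills to its right, or has nonempty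
  content, counted by \<open>P\<close>.\<close>

lemma A_Suc: "A (Suc k) = fps_X * (A k + P * A (Suc k))"
proof (rule fps_ext)
  fix n show "A (Suc k) $ n = (fps_X * (A k + P * A (Suc k))) $ n"
    by (cases n) (simp_all add: P_mult_A_nth, simp_all add: A_def s_0 s_Suc)
qed

text \<open>By \<open>A_0\<close>, \<open>A 0\<close> is the inverse of
  \<open>1 - fps_X * P\<close>, so \<open>A_Suc\<close> can be solved for
  \<open>A (Suc k)\<close>.\<close>

lemma A_Suc': "A (Suc k) = fps_X * A 0 * A k"
proof -
  have "A (Suc k) * (1 - fps_X * P) * A 0 = fps_X * A k * A 0"
    using A_Suc[of k] by algebra
  moreover have "(1 - fps_X * P) * A 0 = 1"
    using A_0 by algebra
  ultimately show ?thesis by algebra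
qed

lemma A_eq: "A k = A 0 * (fps_X * A 0) ^ k"
  by (induction k) (auto simp: A_Suc' mult_ac)

definition R :: "nat \<Rightarrow> int fps" where
  "R k = (A 0 - 1) * (fps_X * A 0) ^ k"

lemma R_Suc: "R (Suc k) = A (Suc k) - fps_X * A k"
  by (simp add: R_def A_eq[of k] A_Suc' algebra_simps)

lemma R_rec: "R k = 2 * fps_X * A (Suc k) + 3 * R (Suc k)"
proof -
  define y where "y = fps_X * A 0"
  \<comment> \<open>By \<open>A_0\<close>, \<open>y * P = A 0 - 1\<close>. Hence \<open>P_eq\<close>
    times \<open>A 0 * y\<close> reads \<open>(A 0 - 1) * A 0 = 2 * y * y + 3 * y * (A 0 - 1) + (A 0
    - 1) * (A 0 - 1)\<close>; subtract the last square.\<close>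
  have "A 0 - 1 = 2 * y * y + 3 * y * (A 0 - 1)"
    using A_0 P_eq unfolding y_def by algebra
  then have "R k = (2 * y * y + 3 * y * (A 0 - 1)) * y ^ k"
    by (simp add: R_def y_def)
  also have "\<dots> = 2 * fps_X * (A 0 * y ^ Suc k) + 3 * ((A 0 - 1) * y ^ Suc k)"
    by (simp add: y_def algebra_simps)
  finally show ?thesis
    unfolding R_def y_def A_eq[of "Suc k"] .
qed

section \<open>Extraction of coefficients\<close>

lemma A_nth_eq_0: "n < k \<Longrightarrow> A k $ n = 0"
  by (subst A_eq) (simp add: power_mult_distrib mult.left_commute[of "A 0"] fps_X_power_mult_nth)

text \<open>Besides the factor \<open>fps_X ^ k\<close>, the vanishing constant term of
  \<open>A 0 - 1\<close> supplies one more power, which covers \<open>n = k\<close>.\<close>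

lemma R_nth_eq_0:
  assumes "n \<le> k"
  shows "R k $ n = 0"
proof -
  have "R k = fps_X ^ k * ((A 0 - 1) * A 0 ^ k)"
    by (simp add: R_def power_mult_distrib mult_ac)
  with assms show ?thesis
    by (simp add: fps_X_power_mult_nth, simp add: A_def s_0)
qed

lemma R_nth_Suc: "R k $ Suc n = 2 * int (s n (Suc k)) + 3 * R (Suc k) $ Suc n"
  by (subst R_rec) (simp add: mult.assoc fps_numeral_fps_const A_def)

text \<open>\<open>R_nth_Suc\<close> is unrolled by induction from \<open>k = n\<close> downwards,
  each round giving a factor 3. For \<open>k > n\<close> both sides vanish.\<close>

lemma R_nth: "R k $ Suc n = int (\<Sum>j = k + 1..n. 2 * 3 ^ (j - k - 1) * s n j)"
proof (cases "k \<le> n")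
  case True
  then show ?thesis
  proof (induction k rule: inc_induct)
    case base
    \<comment> \<open>At \<open>k = n\<close> the sum is empty, and both terms given by
      \<open>R_nth_Suc\<close> must vanish.\<close>
    have "s n (Suc n) = 0"
      using A_nth_eq_0[of n "Suc n"] by (simp add: A_def)
    then show ?case
      using R_nth_Suc[of n n] by (simp add: R_nth_eq_0)
  next
    case (step k)
    have "(\<Sum>j = k + 1..n. 2 * 3 ^ (j - k - 1) * s n j)
        = 2 * s n (Suc k) + (\<Sum>j = Suc k + 1..n. 2 * 3 ^ (j - k - 1) * s n j)"
      using step.hyps by (simp add: sum.atLeast_Suc_atMost)
    also have "(\<Sum>j = Suc k + 1..n. 2 * 3 ^ (j - k - 1) * s n j)
        = (\<Sum>j = Suc k + 1..n. 3 * (2 * 3 ^ (j - Suc k - 1) * s n j))"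
    proof (rule sum.cong)
      fix j assume "j \<in> {Suc k + 1..n}"
      \<comment> \<open>Truncated subtraction is harmless as \<open>j\<close> is at least
        \<open>k + 2\<close>.\<close>
      then have "j - k - 1 = Suc (j - Suc k - 1)" by auto
      then show "2 * 3 ^ (j - k - 1) * s n j = 3 * (2 * 3 ^ (j - Suc k - 1) * s n j)" by simp
    qed simp
    finally show ?case
      using R_nth_Suc[of k n] step.IH by (simp add: sum_distrib_left)
  qed
qed (simp add: R_nth_eq_0)

lemma s_Suc_0_eq: "s (Suc n) 0 = (\<Sum>j = 1..n. 2 * 3 ^ (j - 1) * s n j)"
proof -
  \<comment> \<open>\<open>R 0 = A 0 - 1\<close> differs from \<open>A 0\<close> only in the
    constant term.\<close>
  have "int (s (Suc n) 0) = R 0 $ Suc n"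
    by (simp add: R_def A_def)
  then show ?thesis by (simp only: R_nth of_nat_eq_iff) simp
qed

lemma s_Suc_Suc_eq:
  "s (Suc n) (Suc k) = s n k + (\<Sum>j = Suc k + 1..n. 2 * 3 ^ (j - Suc k - 1) * s n j)"
proof -
  have "int (s (Suc n) (Suc k)) = int (s n k) + R (Suc k) $ Suc n"
    by (simp add: R_Suc A_def)
  then show ?thesis by (simp only: R_nth of_nat_add[symmetric] of_nat_eq_iff)
qed

theorem theorem1p2:
  "s 1 0 = 0 \<and> s 1 1 = 1 \<and>
   (\<forall>n\<ge>2.
      s n 0 = (\<Sum>j = 1..n - 1. 2 * 3 ^ (j - 1) * s (n - 1) j) \<and>
      (\<forall>k. 1 \<le> k \<and> k \<le> n \<longrightarrow>
        s n k = s (n - 1) (k - 1) + (\<Sum>j = k + 1..n - 1. 2 * 3 ^ (j - k - 1) * s (n - 1) j)))"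
proof (intro conjI allI impI)
  show "s 1 0 = 0" "s 1 1 = 1"
    by (simp_all add: s_Suc s_0)
next
  fix n :: nat assume "2 \<le> n"
  then show "s n 0 = (\<Sum>j = 1..n - 1. 2 * 3 ^ (j - 1) * s (n - 1) j)"
    using s_Suc_0_eq[of "n - 1"] by simp
next
  fix n k :: nat assume "2 \<le> n" "1 \<le> k \<and> k \<le> n"
  then show "s n k = s (n - 1) (k - 1) + (\<Sum>j = k + 1..n - 1. 2 * 3 ^ (j - k - 1) * s (n - 1) j)"
    using s_Suc_Suc_eq[of "n - 1" "k - 1"] by simp
qed

end
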